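(* Let $n\geq 1$ and let $\vec{a}=(a_1,\ldots,a_n),\ \vec{b}=(b_1,\ldots,b_n)\in\mathbb{R}^n$ with $a_j,b_j>0$ for all $1\leq j\leq n$, and suppose that $1<\langle\vec{a},\vec{b}\rangle\leq e$. Then for all $s\in\mathbb{N}$, $$\left|\int_{|a_n|}^{|b_n|}\int_{|a_{n-1}|}^{|b_{n-1}|}\cdots\int_{|a_1|}^{|b_1|}\frac{1}{\sqrt[4s+3]{\sum_{j=1}^{n}x_j^{4s+3}}}\;dx_1\,dx_2\cdots dx_n\right|\ \geq\ \frac{2\pi\,|\log(\langle\vec{a},\vec{b}\rangle)|\,\left|\prod_{j=1}^{n}\bigl(|b_j|-|a_j|\bigr)\right|}{\|\vec{a}\|^{4s+4}+\|\vec{b}\|^{4s+4}}.$$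
   Context: $\langle\cdot,\cdot\rangle$ is the inner product on $\mathbb{R}^n$, $\langle\vec{a},\vec{b}\rangle=\sum_j a_jb_j$, and $\|\cdot\|$ is the associated (Euclidean) norm. $\mathbb{N}$ is the set of positive integers. Integrals are iterated oriented integrals ($\int_p^q=-\int_q^p$); the limits $|a_j|,|b_j|$ are not assumed ordered. *)

theory Defs
  imports "HOL-Analysis.Analysis"
begin

text \<open>
  Points of \<open>\<real>\<^sup>n\<close> are represented by functions \<open>nat \<Rightarrow> real\<close> of which only the values at the
  indices \<open>{1..n}\<close> matter.  \<open>iterated_integral n p q f x\<close> is the iterated integral
  \<open>\<integral>\<^bsub>p n\<^esub>\<^bsup>q n\<^esup> \<dots> \<integral>\<^bsub>p 1\<^esub>\<^bsup>q 1\<^esup> f dx\<^sub>1 \<dots> dx\<^sub>n\<close>, with \<open>x\<^sub>1\<close> innermost, in which the coordinates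
  outside \<open>{1..n}\<close> are kept equal to those of the base point \<open>x\<close>; the coordinates of \<open>x\<close> inside
  \<open>{1..n}\<close> are overwritten.  The one-dimensional integrals are oriented: \<open>LBINT t=u..v\<close> changes
  sign when \<open>u\<close> and \<open>v\<close> are exchanged.
\<close>

primrec iterated_integral ::
  "nat \<Rightarrow> (nat \<Rightarrow> real) \<Rightarrow> (nat \<Rightarrow> real) \<Rightarrow> ((nat \<Rightarrow> real) \<Rightarrow> real) \<Rightarrow> (nat \<Rightarrow> real) \<Rightarrow> real"
where
  "iterated_integral 0 p q f x = f x"
| "iterated_integral (Suc k) p q f x =
     (LBINT t=ereal (p (Suc k))..ereal (q (Suc k)). iterated_integral k p q f (x(Suc k := t)))"

end

theory Submission
  imports Defs
begin

text \<open>
  Every integrand value on the box is at least \<open>1 / (\<parallel>a\<parallel> + \<parallel>b\<parallel>)\<close>: with \<open>m = 4s + 3\<close>,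
  \<open>\<Sum>\<^sub>j x\<^sub>j\<^sup>m \<le> \<Sum>\<^sub>j a\<^sub>j\<^sup>m + \<Sum>\<^sub>j b\<^sub>j\<^sup>m \<le> \<parallel>a\<parallel>\<^sup>m + \<parallel>b\<parallel>\<^sup>m \<le> (\<parallel>a\<parallel> + \<parallel>b\<parallel>)\<^sup>m\<close>. With \<open>A = \<parallel>a\<parallel>\<close>, \<open>B = \<parallel>b\<parallel>\<close>
  and \<open>t = \<langle>a, b\<rangle> \<le> AB\<close>, Chebyshev's sum inequality and AM-GM give
  \<open>A\<^bsup>m+1\<^esup> + B\<^bsup>m+1\<^esup> \<ge> (A + B) (A\<^sup>m + B\<^sup>m) / 2 \<ge> (A + B) t\<^sup>3\<close>, and \<open>t\<^sup>3 \<ge> 3e ln t \<ge> 2\<pi> ln t\<close>.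
\<close>

section \<open>Oriented iterated integrals of continuous functions\<close>

text \<open>The sign carries the orientation while \<open>closed_segment\<close> is symmetric in its
  endpoints, so later arguments need not order the limits. For u = v both sides vanish.\<close>

lemma interval_integral_closed_segment:
  fixes u v :: real and g :: "real \<Rightarrow> real"
  assumes "continuous_on (closed_segment u v) g"
  shows "(LBINT t=ereal u..ereal v. g t) = sgn (v - u) * integral (closed_segment u v) g"
proof (cases u v rule: linorder_cases)
  case less
  then have "set_integrable lborel {u..v} g"
    using assms by (intro borel_integrable_atLeastAtMost') (auto simp: closed_segment_eq_real_ivl)
  with less show ?thesis
    by (simp add: interval_integral_eq_integral closed_segment_eq_real_ivl)
next
  case greater
  then have "set_integrable lborel {v..u} g"
    using assms by (intro borel_integrable_atLeastAtMost') (auto simp: closed_segment_eq_real_ivl)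
  with greater show ?thesis
    by (subst interval_integral_endpoints_reverse)
       (simp add: interval_integral_eq_integral closed_segment_eq_real_ivl)
qed simp

lemma sgn_interval_integral_ge:
  fixes u v c :: real and g :: "real \<Rightarrow> real"
  assumes g: "continuous_on (closed_segment u v) g"
    and c: "\<And>t. t \<in> closed_segment u v \<Longrightarrow> c \<le> g t"
  shows "c * \<bar>v - u\<bar> \<le> sgn (v - u) * (LBINT t=ereal u..ereal v. g t)"
proof (cases "u = v")
  case False
  define l r where "l = min u v" and "r = max u v"
  have seg: "closed_segment u v = {l..r}" and "l \<le> r" "\<bar>v - u\<bar> = r - l"
    by (auto simp: closed_segment_eq_real_ivl l_def r_def)
  have "c * \<bar>v - u\<bar> = integral {l..r} (\<lambda>_. c)"
    using \<open>l \<le> r\<close> \<open>\<bar>v - u\<bar> = r - l\<close> by simp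
  also have "\<dots> \<le> integral {l..r} g"
    using g c seg by (intro integral_le integrable_continuous_real) auto
  also have "\<dots> = sgn (v - u) * (LBINT t=ereal u..ereal v. g t)"
    using False seg
    by (simp add: interval_integral_closed_segment[OF g] sgn_if)
  finally show ?thesis .
qed simp

text \<open>After k integrations the first k coordinates are overwritten, so only the later ones
  need a constraint: k = 0 gives the box of the integrand, k = n the whole space.\<close>

definition tail_box :: "nat \<Rightarrow> nat \<Rightarrow> (nat \<Rightarrow> real) \<Rightarrow> (nat \<Rightarrow> real) \<Rightarrow> (nat \<Rightarrow> real) set"
  where "tail_box k n p q = {x. \<forall>j\<in>{k<..n}. x j \<in> closed_segment (p j) (q j)}"

lemma fun_upd_tail_box:
  "x \<in> tail_box (Suc k) n p q \<Longrightarrow> t \<in> closed_segment (p (Suc k)) (q (Suc k))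
     \<Longrightarrow> x(Suc k := t) \<in> tail_box k n p q"
  by (auto simp: tail_box_def)

lemma continuous_on_fun_upd:
  "continuous_on S (\<lambda>(x :: 'i \<Rightarrow> 'a::topological_space, t). x(i := t))"
proof (rule continuous_on_coordinatewise_then_product)
  fix j
  show "continuous_on S (\<lambda>y. (case y of (x, t) \<Rightarrow> x(i := t)) j)"
  proof (cases "j = i")
    case True
    then show ?thesis by (simp add: case_prod_beta continuous_on_snd)
  next
    case False
    have "continuous_on S (\<lambda>y. fst y j)"
      by (rule continuous_on_product_then_coordinatewise) (rule continuous_on_fst[OF continuous_on_id])
    with False show ?thesis by (simp add: case_prod_beta)
  qed
qed

text \<open>Joint continuity in x and t is what continuity of a parameter integral requires.\<close>

lemma continuous_on_slice:
  assumes "continuous_on (tail_box k n p q) F"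
  shows "continuous_on (tail_box (Suc k) n p q \<times> closed_segment (p (Suc k)) (q (Suc k)))
           (\<lambda>(x, t). F (x(Suc k := t)))"
proof -
  have "continuous_on (tail_box (Suc k) n p q \<times> closed_segment (p (Suc k)) (q (Suc k)))
          (\<lambda>y. F (case y of (x, t) \<Rightarrow> x(Suc k := t)))"
    by (rule continuous_on_compose2[OF assms continuous_on_fun_upd])
       (auto intro: fun_upd_tail_box)
  then show ?thesis by (simp add: case_prod_beta)
qed

lemma continuous_on_slice_at:
  assumes "continuous_on (tail_box k n p q) F" and "x \<in> tail_box (Suc k) n p q"
  shows "continuous_on (closed_segment (p (Suc k)) (q (Suc k))) (\<lambda>t. F (x(Suc k := t)))"
proof -
  let ?I = "closed_segment (p (Suc k)) (q (Suc k))"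
  have "continuous_on ?I (\<lambda>t. (x, t))"
    by (intro continuous_intros)
  then show ?thesis
    using continuous_on_compose2[OF continuous_on_slice[OF assms(1)], of ?I "\<lambda>t. (x, t)"] assms(2)
    by (simp add: image_subset_iff del: fun_upd_apply)
qed

text \<open>Continuity of the inner integrals makes every outer integrand integrable, so that it can
  be bounded from below; it passes through each stage as continuity of a parameter integral over a
  compact interval.\<close>

lemma continuous_on_iterated_integral:
  assumes "continuous_on (tail_box 0 n p q) f"
  shows "continuous_on (tail_box k n p q) (iterated_integral k p q f)"
proof (induction k)
  case 0
  then show ?case using assms by simp
next
  case (Suc k)
  let ?I = "closed_segment (p (Suc k)) (q (Suc k))"
  obtain l r where I: "?I = cbox l r"
    by (metis closed_segment_eq_real_ivl cbox_interval)
  have "continuous_on (tail_box (Suc k) n p q)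
          (\<lambda>x. sgn (q (Suc k) - p (Suc k)) * integral ?I (\<lambda>t. iterated_integral k p q f (x(Suc k := t))))"
    using continuous_on_slice[OF Suc.IH] unfolding I
    by (intro continuous_intros integral_continuous_on_param)
  then show ?case
    by (rule continuous_on_eq)
       (simp add: interval_integral_closed_segment[OF continuous_on_slice_at[OF Suc.IH]]
          del: fun_upd_apply)
qed

text \<open>An induction on absolute values would fail, since a bound on the modulus of an integrand
  gives no lower bound on the modulus of its integral. With the sign of the product kept, each stage
  has a genuine lower bound, and signs and lengths multiply.\<close>

lemma sgn_iterated_integral_ge:
  assumes cont: "continuous_on (tail_box 0 n p q) f"
    and lower: "\<And>x. x \<in> tail_box 0 n p q \<Longrightarrow> c \<le> f x"
    and "x \<in> tail_box k n p q"
  shows "c * \<bar>\<Prod>j=1..k. (q j - p j)\<bar>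
           \<le> sgn (\<Prod>j=1..k. (q j - p j)) * iterated_integral k p q f x"
  using assms(3)
proof (induction k arbitrary: x)
  case 0
  then show ?case using lower by simp
next
  case (Suc k)
  let ?P = "\<Prod>j=1..k. (q j - p j)" and ?d = "q (Suc k) - p (Suc k)"
  let ?g = "\<lambda>t. sgn ?P * iterated_integral k p q f (x(Suc k := t))"
  have "c * \<bar>?P\<bar> * \<bar>?d\<bar> \<le> sgn ?d * (LBINT t=ereal (p (Suc k))..ereal (q (Suc k)). ?g t)"
  proof (rule sgn_interval_integral_ge)
    show "continuous_on (closed_segment (p (Suc k)) (q (Suc k))) ?g"
      by (intro continuous_on_mult_left
          continuous_on_slice_at[OF continuous_on_iterated_integral[OF cont] Suc.prems])
    show "c * \<bar>?P\<bar> \<le> ?g t" if "t \<in> closed_segment (p (Suc k)) (q (Suc k))" for t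
      by (rule Suc.IH[OF fun_upd_tail_box[OF Suc.prems that]])
  qed
  then show ?case
    by (simp add: abs_mult sgn_mult mult_ac)
qed

lemma abs_iterated_integral_ge:
  assumes "continuous_on (tail_box 0 n p q) f"
    and "\<And>x. x \<in> tail_box 0 n p q \<Longrightarrow> c \<le> f x"
  shows "c * \<bar>\<Prod>j=1..n. (q j - p j)\<bar> \<le> \<bar>iterated_integral n p q f x\<bar>"
proof -
  have "x \<in> tail_box n n p q" by (simp add: tail_box_def)
  from sgn_iterated_integral_ge[OF assms this] show ?thesis
    \<comment> \<open>If the product is zero, the left side is zero; otherwise the sign is 1 or -1
      and the signed value is at most the modulus.\<close>
    by (auto simp: sgn_if split: if_splits)
qed

section \<open>The pointwise estimate\<close>

text \<open>Each entry is at most the norm: m - 2 factors are replaced by it, and the remaining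
  squares sum to its square.\<close>

lemma sum_power_le_L2_set_power:
  assumes "\<And>j. j \<in> S \<Longrightarrow> 0 \<le> a j" and "2 \<le> m"
  shows "(\<Sum>j\<in>S. a j ^ m) \<le> L2_set a S ^ m"
proof (cases "finite S")
  case True
  have m: "m = (m - 2) + 2" using assms(2) by simp
  have "(\<Sum>j\<in>S. a j ^ m) = (\<Sum>j\<in>S. a j ^ (m - 2) * (a j)\<^sup>2)"
    by (subst m) (simp only: power_add)
  also have "\<dots> \<le> (\<Sum>j\<in>S. L2_set a S ^ (m - 2) * (a j)\<^sup>2)"
    using assms True by (intro sum_mono mult_right_mono power_mono member_le_L2_set) auto
  also have "\<dots> = L2_set a S ^ (m - 2) * (L2_set a S)\<^sup>2"
    by (simp add: sum_distrib_left L2_set_def sum_nonneg)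
  also have "\<dots> = L2_set a S ^ m"
    using m by (metis power_add)
  finally show ?thesis .
qed (use assms in simp)

lemma add_powers_le_power_add:
  fixes x y :: "'a::linordered_semidom"
  assumes "0 \<le> x" "0 \<le> y" "1 \<le> m"
  shows "x ^ m + y ^ m \<le> (x + y) ^ m"
  using assms(3)
proof (induction m rule: dec_induct)
  case (step m)
  have "x ^ Suc m + y ^ Suc m \<le> (x + y) * (x ^ m + y ^ m)"
    using assms by (simp add: algebra_simps add_increasing)
  also have "\<dots> \<le> (x + y) * (x + y) ^ m"
    using assms step by (intro mult_left_mono) auto
  finally show ?case by simp
qed simp

lemma root_sum_powers_le:
  assumes "\<And>j. j \<in> S \<Longrightarrow> 0 < a j" "\<And>j. j \<in> S \<Longrightarrow> 0 < b j"
    and x: "\<And>j. j \<in> S \<Longrightarrow> x j \<in> closed_segment (a j) (b j)" and "2 \<le> m"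
  shows "root m (\<Sum>j\<in>S. x j ^ m) \<le> L2_set a S + L2_set b S"
proof -
  have "x j ^ m \<le> a j ^ m + b j ^ m" if "j \<in> S" for j
  proof -
    \<comment> \<open>The endpoints are unordered; whichever bounds \<open>x j\<close>, the sum of
      both powers covers it.\<close>
    have "0 \<le> x j" "x j \<le> a j \<or> x j \<le> b j"
      using assms(1,2)[OF that] x[OF that] by (auto simp: closed_segment_eq_real_ivl split: if_splits)
    then have "x j ^ m \<le> a j ^ m \<or> x j ^ m \<le> b j ^ m"
      by (auto intro: power_mono)
    moreover have "0 \<le> a j ^ m" "0 \<le> b j ^ m"
      using assms(1,2)[OF that] by auto
    ultimately show ?thesis by linarith
  qed
  then have "(\<Sum>j\<in>S. x j ^ m) \<le> (\<Sum>j\<in>S. a j ^ m) + (\<Sum>j\<in>S. b j ^ m)"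
    by (simp add: sum_mono flip: sum.distrib)
  also have "\<dots> \<le> L2_set a S ^ m + L2_set b S ^ m"
    using assms by (intro add_mono sum_power_le_L2_set_power) (auto intro: less_imp_le)
  also have "\<dots> \<le> (L2_set a S + L2_set b S) ^ m"
    using assms by (intro add_powers_le_power_add) auto
  finally have "root m (\<Sum>j\<in>S. x j ^ m) \<le> root m ((L2_set a S + L2_set b S) ^ m)"
    using assms by simp
  then show ?thesis using assms by (simp add: real_root_power_cancel)
qed

section \<open>Scalar inequalities linking the logarithm and the norms\<close>

lemma two_pi_ln_le_cube:
  assumes "0 < (t::real)"
  shows "2 * pi * ln t \<le> t ^ 3"
proof (cases "1 \<le> t")
  case True
  \<comment> \<open>Dividing by e makes the constants cancel: the logarithm is 3 ln t - 1.\<close>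
  have "ln (t ^ 3 / exp 1) \<le> t ^ 3 / exp 1 - 1"
    using assms by (intro ln_le_minus_one) simp
  then have "3 * ln t \<le> t ^ 3 / exp 1"
    using assms by (simp add: ln_div ln_realpow)
  then have *: "3 * exp 1 * ln t \<le> t ^ 3"
    by (simp add: field_simps)
  \<comment> \<open>The number 8 separates 2 pi from 3e.\<close>
  have "8 \<le> 3 * exp (1::real)"
    using e_approx_32 by (simp add: abs_if split: if_splits)
  then have "2 * pi * ln t \<le> 3 * exp 1 * ln t"
    using pi_less_4 True by (intro mult_right_mono) auto
  with * show ?thesis by linarith
next
  case False
  then have "2 * pi * ln t \<le> 0"
    using assms by (intro mult_nonneg_nonpos) auto
  with assms show ?thesis by (smt (verit) zero_less_power)
qed

lemma add_mult_cube_le_add_powers: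
  fixes A B t :: real
  assumes "0 \<le> A" "0 \<le> B" "1 \<le> t" "t \<le> A * B" "6 \<le> m"
  shows "(A + B) * t ^ 3 \<le> A ^ Suc m + B ^ Suc m"
proof -
  have "(t ^ 3)\<^sup>2 = t ^ 6" by (simp flip: power_mult)
  \<comment> \<open>The squared cube is the sixth power, whence the bound 6 on m.\<close>
  also have "\<dots> \<le> t ^ m" using assms by (intro power_increasing)
  also have "\<dots> \<le> (A * B) ^ m" using assms by (intro power_mono) auto
  finally have "4 * (t ^ 3)\<^sup>2 \<le> 4 * (A ^ m * B ^ m)" by (simp add: power_mult_distrib)
  also have "\<dots> \<le> (A ^ m + B ^ m)\<^sup>2"
    using zero_le_power2[of "A ^ m - B ^ m"] by (simp add: power2_eq_square algebra_simps)
  finally have "(2 * t ^ 3)\<^sup>2 \<le> (A ^ m + B ^ m)\<^sup>2" by (simp add: power_mult_distrib)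
  then have "2 * t ^ 3 \<le> A ^ m + B ^ m"
    by (rule power2_le_imp_le) (use assms in simp)
  then have "(A + B) * (2 * t ^ 3) \<le> (A + B) * (A ^ m + B ^ m)"
    using assms by (intro mult_left_mono) auto
  \<comment> \<open>Chebyshev's inequality for two terms: both factors have the same sign, and
    expanding bounds the mixed terms by the pure powers.\<close>
  moreover have "0 \<le> (A - B) * (A ^ m - B ^ m)"
  proof (cases "A \<le> B")
    case True
    then show ?thesis using assms by (intro mult_nonpos_nonpos) (auto intro: power_mono)
  next
    case False
    then show ?thesis using assms by (intro mult_nonneg_nonneg) (auto intro: power_mono)
  qed
  ultimately show ?thesis by (simp add: algebra_simps)
qed

theorem theorem1p3:
  fixes n s :: nat and a b :: "nat \<Rightarrow> real"
  assumes "n \<ge> 1"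
    and "\<And>j. j \<in> {1..n} \<Longrightarrow> a j > 0"
    and "\<And>j. j \<in> {1..n} \<Longrightarrow> b j > 0"
    and "1 < (\<Sum>j=1..n. a j * b j)"
    and "(\<Sum>j=1..n. a j * b j) \<le> exp 1"
    and "s \<ge> 1"
  shows "\<bar>iterated_integral n (\<lambda>j. \<bar>a j\<bar>) (\<lambda>j. \<bar>b j\<bar>)
            (\<lambda>x. 1 / root (4 * s + 3) (\<Sum>j=1..n. x j ^ (4 * s + 3))) (\<lambda>_. 0)\<bar>
         \<ge> 2 * pi * \<bar>ln (\<Sum>j=1..n. a j * b j)\<bar> * \<bar>\<Prod>j=1..n. (\<bar>b j\<bar> - \<bar>a j\<bar>)\<bar>
            / (L2_set a {1..n} ^ (4 * s + 4) + L2_set b {1..n} ^ (4 * s + 4))"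
proof -
  define m where "m = 4 * s + 3"
  define t where "t = (\<Sum>j=1..n. a j * b j)"
  define A B where "A = L2_set a {1..n}" and "B = L2_set b {1..n}"
  define f where "f = (\<lambda>x :: nat \<Rightarrow> real. 1 / root m (\<Sum>j=1..n. x j ^ m))"
  define X where "X = tail_box 0 n (\<lambda>j. \<bar>a j\<bar>) (\<lambda>j. \<bar>b j\<bar>)"
  have m: "6 \<le> m" "2 \<le> m" "0 < m" using assms(6) by (auto simp: m_def)
  have t: "1 < t" using assms(4) by (simp add: t_def)
  have nonneg: "0 \<le> A" "0 \<le> B" by (simp_all add: A_def B_def)
  have seg: "x j \<in> closed_segment (a j) (b j)" if "x \<in> X" "j \<in> {1..n}" for x j
  proof -
    have "x j \<in> closed_segment \<bar>a j\<bar> \<bar>b j\<bar>"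
      using that by (auto simp: X_def tail_box_def)
    then show ?thesis using assms(2,3)[OF that(2)] by simp
  qed
  \<comment> \<open>Keeps the root away from 0 on the box, which both the continuity of
    \<open>f\<close> and the comparison of reciprocals need.\<close>
  have pos: "0 < (\<Sum>j=1..n. x j ^ m)" if "x \<in> X" for x
  proof (rule sum_pos)
    fix j assume j: "j \<in> {1..n}"
    show "0 < x j ^ m"
      using assms(2,3)[OF j] seg[OF that j]
      by (intro zero_less_power) (auto simp: closed_segment_eq_real_ivl split: if_splits)
  qed (use assms(1) in auto)
  have "t \<le> (\<Sum>j=1..n. \<bar>a j\<bar> * \<bar>b j\<bar>)"
    unfolding t_def by (intro sum_mono) (simp flip: abs_mult)
  also have "\<dots> \<le> A * B" unfolding A_def B_def by (rule L2_set_mult_ineq)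
  finally have "t \<le> A * B" .
  have "2 * pi * ln t * (A + B) \<le> t ^ 3 * (A + B)"
    using t nonneg by (intro mult_right_mono two_pi_ln_le_cube) auto
  also have "\<dots> \<le> A ^ Suc m + B ^ Suc m"
    using add_mult_cube_le_add_powers[OF nonneg _ \<open>t \<le> A * B\<close> m(1)] t by (simp add: mult.commute)
  finally have key: "2 * pi * ln t * (A + B) \<le> A ^ Suc m + B ^ Suc m" .
  \<comment> \<open>A zero norm would contradict 1 < t \<le> AB.\<close>
  have "0 < A" "0 < B"
    using t nonneg \<open>t \<le> A * B\<close> by (cases "A = 0"; cases "B = 0"; simp)+
  \<comment> \<open>The constant is the final quotient without the product of lengths, which
    integration over the box supplies.\<close>
  have lower: "2 * pi * ln t / (A ^ Suc m + B ^ Suc m) \<le> f x" if "x \<in> X" for x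
  proof -
    have "2 * pi * ln t / (A ^ Suc m + B ^ Suc m) \<le> 1 / (A + B)"
      using key \<open>0 < A\<close> \<open>0 < B\<close> by (simp add: divide_simps add_pos_pos)
    also have "\<dots> \<le> f x"
      unfolding f_def
    proof (rule divide_left_mono)
      show "root m (\<Sum>j=1..n. x j ^ m) \<le> A + B"
        unfolding A_def B_def using seg[OF that] assms(2,3) m(2) by (intro root_sum_powers_le) auto
      show "0 < (A + B) * root m (\<Sum>j=1..n. x j ^ m)"
        using pos[OF that] m \<open>0 < A\<close> \<open>0 < B\<close> by (intro mult_pos_pos) auto
    qed simp
    finally show ?thesis .
  qed
  have cont: "continuous_on X f"
    unfolding f_def
  proof (intro continuous_intros)
    show "continuous_on X (\<lambda>x. x j)" for j :: nat
      by (rule continuous_on_product_then_coordinatewise[OF continuous_on_id])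
    show "\<forall>x\<in>X. root m (\<Sum>j=1..n. x j ^ m) \<noteq> 0"
      using pos m by fastforce
  qed
  have "2 * pi * ln t / (A ^ Suc m + B ^ Suc m) * \<bar>\<Prod>j=1..n. (\<bar>b j\<bar> - \<bar>a j\<bar>)\<bar>
          \<le> \<bar>iterated_integral n (\<lambda>j. \<bar>a j\<bar>) (\<lambda>j. \<bar>b j\<bar>) f (\<lambda>_. 0)\<bar>"
    using cont lower unfolding X_def by (rule abs_iterated_integral_ge)
  moreover have "\<bar>ln t\<bar> = ln t" "Suc m = 4 * s + 4" using t by (auto simp: m_def)
  ultimately show ?thesis
    unfolding f_def t_def[symmetric] A_def[symmetric] B_def[symmetric] m_def[symmetric]
    by simp
qed

end
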